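(* Let $(\mathscr{G},\{\cdot_\lambda\}_{\lambda\in\Lambda},\{\vartriangleright_\lambda\}_{\lambda\in\Lambda})$ be a dynamical post-group, $\mathscr{G}=(G,\Lambda,\phi_G)$, and set $a\circ_\lambda b=a\cdot_\lambda(a\vartriangleright_\lambda b)$. Then $(\mathscr{G},\{\cdot_\lambda\}_{\lambda\in\Lambda},\{\circ_\lambda\}_{\lambda\in\Lambda})$ is a dynamical skew brace. Moreover, if $\Psi$ is a homomorphism of dynamical post-groups from $(\mathscr{G},\{\cdot_\lambda\},\{\vartriangleright_\lambda\})$ to $(\mathscr{H},\{\cdot'_\lambda\},\{\vartriangleright'_\lambda\})$, then $\Psi$ induces a homomorphism of the corresponding dynamical skew braces from $(\mathscr{G},\{\cdot_\lambda\},\{\circ_\lambda\})$ to $(\mathscr{H},\{\cdot'_\lambda\},\{\circ'_\lambda\})$ (namely $\Psi$ itself).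
   Context: Fix a set $\Lambda$. A dynamical set is a triple $\mathscr{X}=(X,\Lambda,\phi_X)$ with $X$ a set and $\phi_X:\Lambda\times X\to\Lambda$ a map. A morphism $\mathscr{X}\to\mathscr{Y}$ is a map $f:\Lambda\times X\to Y$, $f_\lambda=f(\lambda,-)$, with $\phi_Y(\lambda,f_\lambda(x))=\phi_X(\lambda,x)$. Dynamical group: a dynamical set $\mathscr{G}=(G,\Lambda,\phi_G)$ with maps $\circ_\lambda:G\times G\to G$ such that $\phi_G(\lambda,a\circ_\lambda b)=\phi_G(\phi_G(\lambda,a),b)$ and $a\circ_\lambda(b\circ_{\phi_G(\lambda,a)}c)=(a\circ_\lambda b)\circ_\lambda c$; an element $e_G$ with $a\circ_\lambda e_G=e_G\circ_\lambda a=a$ and $\phi_G(\lambda,e_G)=\lambda$; and for all $\lambda,a$ an element $\bar a^\lambda$ with $a\circ_\lambda\bar a^\lambda=\bar a^\lambda\circ_{\phi_G(\lambda,a)}a=e_G$. A constant dynamical group is a dynamical group whose structure map is $(\lambda,x)\mapsto\lambda$, i.e. a family of group structures $\cdot_\lambda$ ($\lambda\in\Lambda$) on one set with a common unit; $a^\lambda$ denotes the inverse of $a$ for $\cdot_\lambda$. Dynamical post-group: a dynamical set $\mathscr{G}=(G,\Lambda,\phi_G)$ with maps $\cdot_\lambda,\vartriangleright_\lambda:G\times G\to G$ ($\lambda\in\Lambda$) such that $(G,\Lambda,\{\cdot_\lambda\})$ is a constant dynamical group; and for all $\lambda\in\Lambda$, $a,b,c\in G$: $a\vartriangleright_\lambda(b\cdot_{\phi_G(\lambda,a)}c)=(a\vartriangleright_\lambda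 b)\cdot_\lambda(a\vartriangleright_\lambda c)$; $(a\cdot_\lambda(a\vartriangleright_\lambda b))\vartriangleright_\lambda c=a\vartriangleright_\lambda(b\vartriangleright_{\phi_G(\lambda,a)}c)$; and the map $b\mapsto a\vartriangleright_\lambda b$ is invertible. A homomorphism of dynamical post-groups is a morphism of dynamical sets $\Psi:\mathscr{G}\to\mathscr{H}$ with $\Psi_\lambda(a\cdot_\lambda b)=\Psi_\lambda(a)\cdot'_\lambda\Psi_\lambda(b)$ and $\Psi_\lambda(a\vartriangleright_\lambda b)=\Psi_\lambda(a)\vartriangleright'_\lambda\Psi_{\phi_G(\lambda,a)}(b)$. Dynamical skew brace $(\mathscr{G},\{\cdot_\lambda\},\{\circ_\lambda\})$: $(G,\Lambda,\{\cdot_\lambda\})$ is a constant dynamical group, $(\mathscr{G},\{\circ_\lambda\})$ is a dynamical group, and $a\circ_\lambda(b\cdot_{\phi_G(\lambda,a)}c)=(a\circ_\lambda b)\cdot_\lambda a^\lambda\cdot_\lambda(a\circ_\lambda c)$. A homomorphism of dynamical skew braces is a morphism of dynamical sets $\Psi$ with $\Psi_\lambda(a\cdot_\lambda b)=\Psi_\lambda(a)\cdot'_\lambda\Psi_\lambda(b)$ and $\Psi_\lambda(a\circ_\lambda b)=\Psi_\lambda(a)\circ'_\lambda\Psi_{\phi_G(\lambda,a)}(b)$.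
   Formalization: The skew brace claim is proved under the added (necessary) conditions φ_G(λ,e)=λ and φ_G(λ,a∘_λ b)=φ_G(φ_G(λ,a),b), which the post-group axioms do not imply (e.g. Λ two points, G=Z/2, trivial action, φ_G constant); the homomorphism claim needs no extra condition. *)

theory Defs
  imports Main
begin

text \<open>
  A family of maps indexed by a set \<open>L\<close> is a curried HOL function whose values matter only on
  \<open>L\<close> and on the carriers. No carrier, nor \<open>L\<close>, is assumed to be nonempty.
\<close>

definition dynamical_set :: "'l set \<Rightarrow> 'x set \<Rightarrow> ('l \<Rightarrow> 'x \<Rightarrow> 'l) \<Rightarrow> bool" where
  "dynamical_set L X \<phi> \<longleftrightarrow> (\<forall>l\<in>L. \<forall>x\<in>X. \<phi> l x \<in> L)"

definition dynamical_set_morphism ::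
  "'l set \<Rightarrow> 'x set \<Rightarrow> ('l \<Rightarrow> 'x \<Rightarrow> 'l) \<Rightarrow> 'y set \<Rightarrow> ('l \<Rightarrow> 'y \<Rightarrow> 'l) \<Rightarrow> ('l \<Rightarrow> 'x \<Rightarrow> 'y) \<Rightarrow> bool" where
  "dynamical_set_morphism L X \<phi> Y \<psi> f \<longleftrightarrow>
     dynamical_set L X \<phi> \<and> dynamical_set L Y \<psi> \<and>
     (\<forall>l\<in>L. \<forall>x\<in>X. f l x \<in> Y \<and> \<psi> l (f l x) = \<phi> l x)"

definition dynamical_group ::
  "'l set \<Rightarrow> 'g set \<Rightarrow> ('l \<Rightarrow> 'g \<Rightarrow> 'l) \<Rightarrow> ('l \<Rightarrow> 'g \<Rightarrow> 'g \<Rightarrow> 'g) \<Rightarrow> bool" where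
  "dynamical_group L G \<phi> m \<longleftrightarrow>
     dynamical_set L G \<phi> \<and>
     (\<forall>l\<in>L. \<forall>a\<in>G. \<forall>b\<in>G. m l a b \<in> G) \<and>
     (\<forall>l\<in>L. \<forall>a\<in>G. \<forall>b\<in>G. \<phi> l (m l a b) = \<phi> (\<phi> l a) b) \<and>
     (\<forall>l\<in>L. \<forall>a\<in>G. \<forall>b\<in>G. \<forall>c\<in>G. m l a (m (\<phi> l a) b c) = m l (m l a b) c) \<and>
     (\<exists>e\<in>G. (\<forall>l\<in>L. \<phi> l e = l \<and> (\<forall>a\<in>G. m l a e = a \<and> m l e a = a)) \<and>
        (\<forall>l\<in>L. \<forall>a\<in>G. \<exists>b\<in>G. m l a b = e \<and> m (\<phi> l a) b a = e))"

definition constant_dynamical_group ::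
  "'l set \<Rightarrow> 'g set \<Rightarrow> ('l \<Rightarrow> 'g \<Rightarrow> 'g \<Rightarrow> 'g) \<Rightarrow> bool" where
  "constant_dynamical_group L G m \<longleftrightarrow> dynamical_group L G (\<lambda>l x. l) m"

text \<open>
  Unit and inverse in the single group \<open>(G, m l)\<close>. In a constant dynamical group \<open>unit_at G m l\<close>
  is the same element for all \<open>l \<in> L\<close>.
\<close>

definition unit_at :: "'g set \<Rightarrow> ('l \<Rightarrow> 'g \<Rightarrow> 'g \<Rightarrow> 'g) \<Rightarrow> 'l \<Rightarrow> 'g" where
  "unit_at G m l = (THE e. e \<in> G \<and> (\<forall>a\<in>G. m l a e = a \<and> m l e a = a))"

definition inverse_at :: "'g set \<Rightarrow> ('l \<Rightarrow> 'g \<Rightarrow> 'g \<Rightarrow> 'g) \<Rightarrow> 'l \<Rightarrow> 'g \<Rightarrow> 'g" where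
  "inverse_at G m l a = (THE b. b \<in> G \<and> m l a b = unit_at G m l \<and> m l b a = unit_at G m l)"

text \<open>
  The axioms below put no condition on \<open>\<phi>\<close> beyond being a map: for the trivial action
  \<open>t l a b = b\<close> on a fixed group every \<open>\<phi>\<close> is allowed. Hence neither
  \<open>\<phi> l e = l\<close> nor \<open>\<phi> l (m l a (t l a b)) = \<phi> (\<phi> l a) b\<close>, both of which are axioms of a dynamical
  group, follows from them.
\<close>

definition dynamical_post_group ::
  "'l set \<Rightarrow> 'g set \<Rightarrow> ('l \<Rightarrow> 'g \<Rightarrow> 'l) \<Rightarrow> ('l \<Rightarrow> 'g \<Rightarrow> 'g \<Rightarrow> 'g) \<Rightarrow> ('l \<Rightarrow> 'g \<Rightarrow> 'g \<Rightarrow> 'g) \<Rightarrow> bool" where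
  "dynamical_post_group L G \<phi> m t \<longleftrightarrow>
     dynamical_set L G \<phi> \<and>
     constant_dynamical_group L G m \<and>
     (\<forall>l\<in>L. \<forall>a\<in>G. \<forall>b\<in>G. t l a b \<in> G) \<and>
     (\<forall>l\<in>L. \<forall>a\<in>G. \<forall>b\<in>G. \<forall>c\<in>G. t l a (m (\<phi> l a) b c) = m l (t l a b) (t l a c)) \<and>
     (\<forall>l\<in>L. \<forall>a\<in>G. \<forall>b\<in>G. \<forall>c\<in>G. t l (m l a (t l a b)) c = t l a (t (\<phi> l a) b c)) \<and>
     (\<forall>l\<in>L. \<forall>a\<in>G. bij_betw (t l a) G G)"

definition dynamical_post_group_hom ::
  "'l set \<Rightarrow> 'g set \<Rightarrow> ('l \<Rightarrow> 'g \<Rightarrow> 'l) \<Rightarrow> ('l \<Rightarrow> 'g \<Rightarrow> 'g \<Rightarrow> 'g) \<Rightarrow> ('l \<Rightarrow> 'g \<Rightarrow> 'g \<Rightarrow> 'g) \<Rightarrow>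
   'h set \<Rightarrow> ('l \<Rightarrow> 'h \<Rightarrow> 'l) \<Rightarrow> ('l \<Rightarrow> 'h \<Rightarrow> 'h \<Rightarrow> 'h) \<Rightarrow> ('l \<Rightarrow> 'h \<Rightarrow> 'h \<Rightarrow> 'h) \<Rightarrow>
   ('l \<Rightarrow> 'g \<Rightarrow> 'h) \<Rightarrow> bool" where
  "dynamical_post_group_hom L G \<phi> m t H \<psi> m' t' \<Psi> \<longleftrightarrow>
     dynamical_set_morphism L G \<phi> H \<psi> \<Psi> \<and>
     (\<forall>l\<in>L. \<forall>a\<in>G. \<forall>b\<in>G. \<Psi> l (m l a b) = m' l (\<Psi> l a) (\<Psi> l b)) \<and>
     (\<forall>l\<in>L. \<forall>a\<in>G. \<forall>b\<in>G. \<Psi> l (t l a b) = t' l (\<Psi> l a) (\<Psi> (\<phi> l a) b))"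

definition dynamical_skew_brace ::
  "'l set \<Rightarrow> 'g set \<Rightarrow> ('l \<Rightarrow> 'g \<Rightarrow> 'l) \<Rightarrow> ('l \<Rightarrow> 'g \<Rightarrow> 'g \<Rightarrow> 'g) \<Rightarrow> ('l \<Rightarrow> 'g \<Rightarrow> 'g \<Rightarrow> 'g) \<Rightarrow> bool" where
  "dynamical_skew_brace L G \<phi> m r \<longleftrightarrow>
     constant_dynamical_group L G m \<and>
     dynamical_group L G \<phi> r \<and>
     (\<forall>l\<in>L. \<forall>a\<in>G. \<forall>b\<in>G. \<forall>c\<in>G.
        r l a (m (\<phi> l a) b c) = m l (m l (r l a b) (inverse_at G m l a)) (r l a c))"

definition dynamical_skew_brace_hom ::
  "'l set \<Rightarrow> 'g set \<Rightarrow> ('l \<Rightarrow> 'g \<Rightarrow> 'l) \<Rightarrow> ('l \<Rightarrow> 'g \<Rightarrow> 'g \<Rightarrow> 'g) \<Rightarrow> ('l \<Rightarrow> 'g \<Rightarrow> 'g \<Rightarrow> 'g) \<Rightarrow>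
   'h set \<Rightarrow> ('l \<Rightarrow> 'h \<Rightarrow> 'l) \<Rightarrow> ('l \<Rightarrow> 'h \<Rightarrow> 'h \<Rightarrow> 'h) \<Rightarrow> ('l \<Rightarrow> 'h \<Rightarrow> 'h \<Rightarrow> 'h) \<Rightarrow>
   ('l \<Rightarrow> 'g \<Rightarrow> 'h) \<Rightarrow> bool" where
  "dynamical_skew_brace_hom L G \<phi> m r H \<psi> m' r' \<Psi> \<longleftrightarrow>
     dynamical_set_morphism L G \<phi> H \<psi> \<Psi> \<and>
     (\<forall>l\<in>L. \<forall>a\<in>G. \<forall>b\<in>G. \<Psi> l (m l a b) = m' l (\<Psi> l a) (\<Psi> l b)) \<and>
     (\<forall>l\<in>L. \<forall>a\<in>G. \<forall>b\<in>G. \<Psi> l (r l a b) = r' l (\<Psi> l a) (\<Psi> (\<phi> l a) b))"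

definition post_circ ::
  "('l \<Rightarrow> 'g \<Rightarrow> 'g \<Rightarrow> 'g) \<Rightarrow> ('l \<Rightarrow> 'g \<Rightarrow> 'g \<Rightarrow> 'g) \<Rightarrow> 'l \<Rightarrow> 'g \<Rightarrow> 'g \<Rightarrow> 'g" where
  "post_circ m t l a b = m l a (t l a b)"

end

theory Submission
  imports Defs
begin

text \<open>Write a.b for \<open>m\<close>, a > b for the action \<open>t\<close>, and a o b = a.(a
  > b), suppressing the index. Since a > - turns products into products, both bracketings of a o b o
  c expand to a.(a > b).(a > (b > c)), so o is associative (\<open>circ_assoc\<close>). The same
  distributivity gives the brace identity once an inverse of a is cancelled against a
  (\<open>circ_mult\<close>). The action fixes the unit, and the unit acts trivially
  (\<open>act_unit\<close>, \<open>unit_act\<close>), so e is a unit for o. Bijectivity of a > -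
  yields right inverses, which associativity makes two-sided (\<open>circ_inverse_ex\<close>). The
  two laws linking \<phi> to e and to o are hypotheses of this half. A homomorphism preserves o
  because o is composed of the two operations it preserves.\<close>

lemma unit_at_eqI:
  assumes "e \<in> G" "\<And>a. a \<in> G \<Longrightarrow> m l a e = a" "\<And>a. a \<in> G \<Longrightarrow> m l e a = a"
  shows "unit_at G m l = e"
  unfolding unit_at_def
proof (rule the_equality)
  show "e \<in> G \<and> (\<forall>a\<in>G. m l a e = a \<and> m l e a = a)"
    using assms by blast
  show "e' = e" if "e' \<in> G \<and> (\<forall>a\<in>G. m l a e' = a \<and> m l e' a = a)" for e'
    using that assms by metis
qed

text \<open>The unit is a single parameter, not indexed by \<open>l\<close>, which encodes that all
  the groups share it.\<close>

locale constant_dyn_group =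
  fixes L :: "'l set" and G :: "'g set" and m :: "'l \<Rightarrow> 'g \<Rightarrow> 'g \<Rightarrow> 'g" and e :: 'g
  assumes closed: "\<lbrakk>l \<in> L; a \<in> G; b \<in> G\<rbrakk> \<Longrightarrow> m l a b \<in> G"
    and assoc: "\<lbrakk>l \<in> L; a \<in> G; b \<in> G; c \<in> G\<rbrakk> \<Longrightarrow> m l (m l a b) c = m l a (m l b c)"
    and unit_closed: "e \<in> G"
    and unit_right: "\<lbrakk>l \<in> L; a \<in> G\<rbrakk> \<Longrightarrow> m l a e = a"
    and unit_left: "\<lbrakk>l \<in> L; a \<in> G\<rbrakk> \<Longrightarrow> m l e a = a"
    and inverse_ex: "\<lbrakk>l \<in> L; a \<in> G\<rbrakk> \<Longrightarrow> \<exists>b\<in>G. m l a b = e \<and> m l b a = e"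
begin

lemma unit_at_eq: "l \<in> L \<Longrightarrow> unit_at G m l = e"
  by (rule unit_at_eqI) (auto simp: unit_closed unit_left unit_right)

lemma inverse_at:
  assumes "l \<in> L" "a \<in> G"
  shows inverse_at_closed: "inverse_at G m l a \<in> G"
    and inverse_at_right: "m l a (inverse_at G m l a) = e"
    and inverse_at_left: "m l (inverse_at G m l a) a = e"
proof -
  obtain b where b: "b \<in> G" "m l a b = e" "m l b a = e"
    using inverse_ex assms by blast
  \<comment> \<open>Uniqueness of the inverse: c = c.(a.b) = (c.a).b = b.\<close>
  have "c = b" if "c \<in> G" "m l c a = e" for c
    using that b assms assoc unit_left unit_right by metis
  with b have "\<exists>!b. b \<in> G \<and> m l a b = e \<and> m l b a = e"
    by blast
  from theI'[OF this] show "inverse_at G m l a \<in> G" "m l a (inverse_at G m l a) = e"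
    "m l (inverse_at G m l a) a = e"
    unfolding inverse_at_def unit_at_eq[OF assms(1)] by blast+
qed

lemma idempotent_eq_unit:
  assumes "l \<in> L" "a \<in> G" "m l a a = a"
  shows "a = e"
  using assms inverse_ex assoc unit_right by metis

lemma inverse_at_cancel_left:
  assumes "l \<in> L" "a \<in> G" "b \<in> G"
  shows "m l (inverse_at G m l a) (m l a b) = b"
  using assms by (simp add: inverse_at assoc[symmetric] unit_left)

end

lemma constant_dyn_groupE:
  assumes "constant_dynamical_group L G m"
  obtains e where "constant_dyn_group L G m e"
proof -
  from assms obtain e where "e \<in> G"
    "\<forall>l\<in>L. \<forall>a\<in>G. m l a e = a \<and> m l e a = a"
    "\<forall>l\<in>L. \<forall>a\<in>G. \<exists>b\<in>G. m l a b = e \<and> m l b a = e"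
    unfolding constant_dynamical_group_def dynamical_group_def by blast
  with assms have "constant_dyn_group L G m e"
    unfolding constant_dynamical_group_def dynamical_group_def
    by unfold_locales auto
  then show thesis ..
qed

text \<open>The last two assumptions go beyond the post-group axioms: they are the conditions on
  \<phi> under which the theorem asserts a skew brace.\<close>

locale dyn_post_group = constant_dyn_group +
  fixes \<phi> :: "'a \<Rightarrow> 'b \<Rightarrow> 'a" and t :: "'a \<Rightarrow> 'b \<Rightarrow> 'b \<Rightarrow> 'b"
  assumes dyn_closed: "\<lbrakk>l \<in> L; a \<in> G\<rbrakk> \<Longrightarrow> \<phi> l a \<in> L"
    and act_mult: "\<lbrakk>l \<in> L; a \<in> G; b \<in> G; c \<in> G\<rbrakk> \<Longrightarrow>
      t l a (m (\<phi> l a) b c) = m l (t l a b) (t l a c)"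
    and act_act: "\<lbrakk>l \<in> L; a \<in> G; b \<in> G; c \<in> G\<rbrakk> \<Longrightarrow>
      t l (m l a (t l a b)) c = t l a (t (\<phi> l a) b c)"
    and act_bij: "\<lbrakk>l \<in> L; a \<in> G\<rbrakk> \<Longrightarrow> bij_betw (t l a) G G"
    and dyn_unit: "l \<in> L \<Longrightarrow> \<phi> l e = l"
    and dyn_circ: "\<lbrakk>l \<in> L; a \<in> G; b \<in> G\<rbrakk> \<Longrightarrow> \<phi> l (post_circ m t l a b) = \<phi> (\<phi> l a) b"
begin

lemma act_closed: "\<lbrakk>l \<in> L; a \<in> G; b \<in> G\<rbrakk> \<Longrightarrow> t l a b \<in> G"
  using act_bij bij_betwE by blast

lemma circ_closed: "\<lbrakk>l \<in> L; a \<in> G; b \<in> G\<rbrakk> \<Longrightarrow> post_circ m t l a b \<in> G"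
  by (simp add: post_circ_def closed act_closed)

text \<open>Distributing a > - over e.e = e shows that a > e is idempotent in a group.\<close>

lemma act_unit:
  assumes "l \<in> L" "a \<in> G"
  shows "t l a e = e"
proof (rule idempotent_eq_unit)
  show "m l (t l a e) (t l a e) = t l a e"
    using act_mult[OF assms unit_closed unit_closed]
    by (simp add: unit_left dyn_closed assms unit_closed)
qed (use assms act_closed unit_closed in auto)

text \<open>As e o e = e and \<open>\<phi> l e = l\<close>, acting by e twice is acting by e once;
  an injective idempotent map is the identity.\<close>

lemma unit_act:
  assumes "l \<in> L" "a \<in> G"
  shows "t l e a = a"
proof -
  have "t l e (t l e a) = t l e a"
    using act_act[OF assms(1) unit_closed unit_closed assms(2)]
    by (simp add: act_unit dyn_unit unit_left assms unit_closed)
  moreover have "inj_on (t l e) G"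
    using act_bij assms unit_closed bij_betw_def by blast
  ultimately show ?thesis
    using assms unit_closed act_closed by (meson inj_onD)
qed

lemma circ_unit: "\<lbrakk>l \<in> L; a \<in> G\<rbrakk> \<Longrightarrow> post_circ m t l a e = a"
  by (simp add: post_circ_def act_unit unit_right)

lemma unit_circ: "\<lbrakk>l \<in> L; a \<in> G\<rbrakk> \<Longrightarrow> post_circ m t l e a = a"
  by (simp add: post_circ_def unit_act unit_left)

lemma circ_assoc:
  assumes "l \<in> L" "a \<in> G" "b \<in> G" "c \<in> G"
  shows "post_circ m t l a (post_circ m t (\<phi> l a) b c) = post_circ m t l (post_circ m t l a b) c"
  using assms by (simp add: post_circ_def act_mult act_act assoc closed act_closed dyn_closed)

text \<open>Surjectivity of a > - provides b such that a > b is the inverse of a for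
  \<open>m l\<close>.\<close>

lemma circ_right_inverse_ex:
  assumes "l \<in> L" "a \<in> G"
  shows "\<exists>b\<in>G. post_circ m t l a b = e"
proof -
  have "inverse_at G m l a \<in> t l a ` G"
    using act_bij[OF assms] inverse_at_closed[OF assms] by (simp add: bij_betw_def)
  then show ?thesis
    using inverse_at_right[OF assms] by (auto simp: post_circ_def)
qed

text \<open>
  A right inverse \<open>b\<close> of \<open>a\<close> at \<open>l\<close> leads from \<open>\<phi> l a\<close> back to \<open>l\<close>, so a right inverse of \<open>b\<close>
  at \<open>\<phi> l a\<close> can be compared with \<open>a\<close>.
\<close>

lemma circ_inverse_ex:
  assumes "l \<in> L" "a \<in> G"
  shows "\<exists>b\<in>G. post_circ m t l a b = e \<and> post_circ m t (\<phi> l a) b a = e"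
proof -
  obtain b where b: "b \<in> G" "post_circ m t l a b = e"
    using circ_right_inverse_ex assms by blast
  obtain c where c: "c \<in> G" "post_circ m t (\<phi> l a) b c = e"
    using circ_right_inverse_ex dyn_closed assms b by blast
  have "a = c"
    using circ_assoc[OF assms b(1) c(1)] by (simp add: b c circ_unit unit_circ assms)
  with b c show ?thesis by blast
qed

lemma dynamical_group_circ: "dynamical_group L G \<phi> (post_circ m t)"
  unfolding dynamical_group_def dynamical_set_def
  using unit_closed dyn_closed circ_closed dyn_circ circ_assoc dyn_unit circ_unit unit_circ
    circ_inverse_ex
  by (intro conjI bexI[of _ e]) auto

text \<open>The right side is a.(a > b).a^-1.a.(a > c), where the middle pair cancels.\<close>

lemma circ_mult:
  assumes "l \<in> L" "a \<in> G" "b \<in> G" "c \<in> G"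
  shows "post_circ m t l a (m (\<phi> l a) b c) =
    m l (m l (post_circ m t l a b) (inverse_at G m l a)) (post_circ m t l a c)"
  using assms
  by (simp add: post_circ_def act_mult assoc closed act_closed inverse_at_closed
      inverse_at_cancel_left)

end

theorem proposition5p5:
  fixes L :: "'l set"
    and G :: "'g set" and \<phi> :: "'l \<Rightarrow> 'g \<Rightarrow> 'l" and m t :: "'l \<Rightarrow> 'g \<Rightarrow> 'g \<Rightarrow> 'g"
  assumes post: "dynamical_post_group L G \<phi> m t"
  shows "((\<forall>l\<in>L. \<phi> l (unit_at G m l) = l) \<and>
          (\<forall>l\<in>L. \<forall>a\<in>G. \<forall>b\<in>G. \<phi> l (post_circ m t l a b) = \<phi> (\<phi> l a) b)
          \<longrightarrow> dynamical_skew_brace L G \<phi> m (post_circ m t)) \<and>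
         (\<forall>(H :: 'h set) \<psi> m' t' \<Psi>.
            dynamical_post_group L H \<psi> m' t' \<longrightarrow>
            dynamical_post_group_hom L G \<phi> m t H \<psi> m' t' \<Psi> \<longrightarrow>
            dynamical_skew_brace_hom L G \<phi> m (post_circ m t) H \<psi> m' (post_circ m' t') \<Psi>)"
proof (intro conjI impI allI)
  assume \<phi>: "(\<forall>l\<in>L. \<phi> l (unit_at G m l) = l) \<and>
    (\<forall>l\<in>L. \<forall>a\<in>G. \<forall>b\<in>G. \<phi> l (post_circ m t l a b) = \<phi> (\<phi> l a) b)"
  have const: "constant_dynamical_group L G m"
    using post by (simp add: dynamical_post_group_def)
  then obtain e where "constant_dyn_group L G m e"
    by (rule constant_dyn_groupE)
  then interpret constant_dyn_group L G m e .
  interpret dyn_post_group L G m e \<phi> t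
    \<comment> \<open>\<open>unit_at_eq\<close> turns the hypothesis on \<open>unit_at G m l\<close>
      into \<open>\<phi> l e = l\<close>.\<close>
    using post \<phi> unfolding dynamical_post_group_def dynamical_set_def
    by unfold_locales (auto simp: unit_at_eq)
  show "dynamical_skew_brace L G \<phi> m (post_circ m t)"
    using const dynamical_group_circ circ_mult by (simp add: dynamical_skew_brace_def)
next
  fix H :: "'h set" and \<psi> m' t' \<Psi>
  assume "dynamical_post_group_hom L G \<phi> m t H \<psi> m' t' \<Psi>"
  \<comment> \<open>Closure lets the multiplicativity of \<Psi> be applied to \<open>a\<close> and
    \<open>t l a b\<close>.\<close>
  moreover have "\<forall>l\<in>L. \<forall>a\<in>G. \<forall>b\<in>G. t l a b \<in> G"
    using post by (simp add: dynamical_post_group_def)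
  ultimately show
    "dynamical_skew_brace_hom L G \<phi> m (post_circ m t) H \<psi> m' (post_circ m' t') \<Psi>"
    by (simp add: dynamical_post_group_hom_def dynamical_skew_brace_hom_def post_circ_def)
qed

end
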